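(* Let $L\ge2$ be an integer and, for $\operatorname{Im}\tau>0$ with $\frac1{L+1}\notin\mathbb{Z}+\tau\mathbb{Z}$, let $[z]=\theta\big(z/(L+1),\tau\big)/\big(\theta'(0,\tau)/(L+1)\big)$. For $a\in\mathbb{Z}+b$ put $$T^{\mathrm{ell}}_A(a)=\frac{\sqrt{[a-1][a+1]}}{[a]}\big(E_{21}\otimes E_{12}+E_{12}\otimes E_{21}\big)+\frac{[a+1]}{[a]}E_{11}\otimes E_{22}+\frac{[a-1]}{[a]}E_{22}\otimes E_{11},$$ $$\check R^{\mathrm{ell}}_A(z,a)=\sum_{i=1}^2E_{ii}\otimes E_{ii}+\frac{\sqrt{[a-1][a+1]}\,[z]}{[a][1-z]}\big(E_{21}\otimes E_{12}+E_{12}\otimes E_{21}\big)+\frac{[a+z][1]}{[a][1-z]}E_{11}\otimes E_{22}+\frac{[a-z][1]}{[a][1-z]}E_{22}\otimes E_{11}.$$ With $\langle z\rangle=\sin\big(\frac{\pi z}{L+1}\big)$, put $$T^{\mathrm{tri}}_A(a)=\frac{\sqrt{\langle a-1\rangle\langle a+1\rangle}}{\langle a\rangle}\big(E_{21}\otimes E_{12}+E_{12}\otimes E_{21}\big)+\frac{\langle a+1\rangle}{\langle a\rangle}E_{11}\otimes E_{22}+\frac{\langle a-1\rangle}{\langle a\rangle}E_{22}\otimes E_{11},\qquad \check R^{\mathrm{tri}}_A(z,a)=\mathrm{id}+\frac{\langle z\rangle}{\langle1-z\rangle}T^{\mathrm{tri}}_A(a).$$ Then in the trigonometric limit $\tau\to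 i\infty$ one has $\check R_A^{\mathrm{ell}}(z,a)\to\check R_A^{\mathrm{tri}}(z,a)$ and $T_A^{\mathrm{ell}}(a)\to T_A^{\mathrm{tri}}(a)$, for all $a\in\mathbb{Z}+b$ and generic $z\in\mathbb{C}$.
   Context: $b\in\mathbb{C}$ is generic (so that denominators do not vanish; in particular $\langle a\rangle\neq0$ for $a\in\mathbb{Z}+b$). $\theta(z,\tau)=-\sum_{n\in\mathbb{Z}}e^{i\pi(n+\frac12)^2\tau+2\pi i(n+\frac12)(z+\frac12)}$ is the odd Jacobi theta function and $\theta'$ its derivative in $z$. All operators act on $\mathbb{C}^2\otimes\mathbb{C}^2$ with basis $e_i\otimes e_j$, $E_{ij}$ being the $2\times2$ matrix unit with $E_{ij}e_k=\delta_{jk}e_i$. The branches of the square roots are chosen compatibly: for $\operatorname{Im}\tau$ large, $\sqrt{[a-1][a+1]}$ is the square root close to $\frac{L+1}{\pi}\sqrt{\langle a-1\rangle\langle a+1\rangle}$. *)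

theory Defs
  imports "HOL-Analysis.Analysis"
begin

definition theta :: "complex \<Rightarrow> complex \<Rightarrow> complex" where
  "theta z \<tau> = - (\<Sum>\<^sub>\<infinity>n\<in>(UNIV :: int set).
     exp (\<i> * of_real pi * (of_int n + 1/2)\<^sup>2 * \<tau>
          + 2 * of_real pi * \<i> * (of_int n + 1/2) * (z + 1/2)))"

definition admissible :: "nat \<Rightarrow> complex \<Rightarrow> bool" where
  "admissible L \<tau> \<longleftrightarrow> Im \<tau> > 0 \<and>
     1 / (of_nat L + 1) \<notin> {of_int m + \<tau> * of_int n | m n :: int. True}"

definition ell :: "nat \<Rightarrow> complex \<Rightarrow> complex \<Rightarrow> complex" where
  "ell L \<tau> z = theta (z / (of_nat L + 1)) \<tau>
     / (deriv (\<lambda>w. theta w \<tau>) 0 / (of_nat L + 1))"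

definition tri :: "nat \<Rightarrow> complex \<Rightarrow> complex" where
  "tri L z = sin (of_real pi * z / (of_nat L + 1))"

text \<open>The limit \<open>\<tau> \<rightarrow> i\<infinity>\<close> means \<open>Im \<tau> \<rightarrow> \<infinity>\<close>, with no restriction on the real part.\<close>

definition at_ii_inf :: "complex filter" where
  "at_ii_inf = filtercomap Im at_top"

text \<open>Operators on \<open>\<complex>\<^sup>2 \<otimes> \<complex>\<^sup>2\<close> are matrices over the index type \<open>2 \<times> 2\<close>, where
  \<open>e\<^sub>i \<otimes> e\<^sub>j\<close> is the basis vector with index \<open>(i, j)\<close>; in the type \<open>2\<close>
  the numerals 1 and 2 denote its two distinct elements. Convergence
  of operators is entrywise.\<close>

type_synonym op22 = "complex ^ (2 \<times> 2) ^ (2 \<times> 2)"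

definition E :: "2 \<Rightarrow> 2 \<Rightarrow> complex ^ 2 ^ 2" where
  "E i j = (\<chi> k l. if k = i \<and> l = j then 1 else 0)"

definition tensor :: "complex ^ 2 ^ 2 \<Rightarrow> complex ^ 2 ^ 2 \<Rightarrow> op22"  (infixl "\<otimes>\<^sub>m" 72) where
  "A \<otimes>\<^sub>m B = (\<chi> p q. A $ fst p $ fst q * B $ snd p $ snd q)"

definition op_scale :: "complex \<Rightarrow> op22 \<Rightarrow> op22"  (infixr "*\<^sub>o" 70) where
  "c *\<^sub>o A = (\<chi> p q. c * A $ p $ q)"

text \<open>The argument \<open>\<rho>\<close> of the operators below is the chosen square root of
  \<open>[a - 1] [a + 1]\<close>, respectively of \<open>\<langle>a - 1\<rangle> \<langle>a + 1\<rangle>\<close>.\<close>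

definition T_ell :: "nat \<Rightarrow> complex \<Rightarrow> complex \<Rightarrow> complex \<Rightarrow> op22" where
  "T_ell L \<tau> \<rho> a =
     (\<rho> / ell L \<tau> a) *\<^sub>o (E 2 1 \<otimes>\<^sub>m E 1 2 + E 1 2 \<otimes>\<^sub>m E 2 1)
     + (ell L \<tau> (a + 1) / ell L \<tau> a) *\<^sub>o (E 1 1 \<otimes>\<^sub>m E 2 2)
     + (ell L \<tau> (a - 1) / ell L \<tau> a) *\<^sub>o (E 2 2 \<otimes>\<^sub>m E 1 1)"

definition R_ell :: "nat \<Rightarrow> complex \<Rightarrow> complex \<Rightarrow> complex \<Rightarrow> complex \<Rightarrow> op22" where
  "R_ell L \<tau> \<rho> z a =
     (\<Sum>i\<in>UNIV. E i i \<otimes>\<^sub>m E i i)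
     + (\<rho> * ell L \<tau> z / (ell L \<tau> a * ell L \<tau> (1 - z)))
         *\<^sub>o (E 2 1 \<otimes>\<^sub>m E 1 2 + E 1 2 \<otimes>\<^sub>m E 2 1)
     + (ell L \<tau> (a + z) * ell L \<tau> 1 / (ell L \<tau> a * ell L \<tau> (1 - z)))
         *\<^sub>o (E 1 1 \<otimes>\<^sub>m E 2 2)
     + (ell L \<tau> (a - z) * ell L \<tau> 1 / (ell L \<tau> a * ell L \<tau> (1 - z)))
         *\<^sub>o (E 2 2 \<otimes>\<^sub>m E 1 1)"

definition T_tri :: "nat \<Rightarrow> complex \<Rightarrow> complex \<Rightarrow> op22" where
  "T_tri L \<rho> a =
     (\<rho> / tri L a) *\<^sub>o (E 2 1 \<otimes>\<^sub>m E 1 2 + E 1 2 \<otimes>\<^sub>m E 2 1)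
     + (tri L (a + 1) / tri L a) *\<^sub>o (E 1 1 \<otimes>\<^sub>m E 2 2)
     + (tri L (a - 1) / tri L a) *\<^sub>o (E 2 2 \<otimes>\<^sub>m E 1 1)"

definition R_tri :: "nat \<Rightarrow> complex \<Rightarrow> complex \<Rightarrow> complex \<Rightarrow> op22" where
  "R_tri L \<rho> z a = mat 1 + (tri L z / tri L (1 - z)) *\<^sub>o T_tri L \<rho> a"

text \<open>Compatible branches: \<open>s a\<close> is any square root of \<open>\<langle>a - 1\<rangle> \<langle>a + 1\<rangle>\<close>, and
  \<open>r \<tau> a\<close> is a square root of \<open>[a - 1] [a + 1]\<close> which, once \<open>Im \<tau>\<close> is large
  (depending on \<open>a\<close>), is the one of the two roots \<open>r \<tau> a\<close>, \<open>- r \<tau> a\<close> that lies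
  closer to \<open>(L + 1) / \<pi> * s a\<close>.\<close>

definition compatible_roots ::
  "nat \<Rightarrow> complex \<Rightarrow> (complex \<Rightarrow> complex \<Rightarrow> complex) \<Rightarrow> (complex \<Rightarrow> complex) \<Rightarrow> bool" where
  "compatible_roots L b r s \<longleftrightarrow>
     (\<forall>a. a - b \<in> \<int> \<longrightarrow>
        (s a)\<^sup>2 = tri L (a - 1) * tri L (a + 1) \<and>
        (\<forall>\<tau>. admissible L \<tau> \<longrightarrow> (r \<tau> a)\<^sup>2 = ell L \<tau> (a - 1) * ell L \<tau> (a + 1)) \<and>
        (\<forall>\<^sub>F \<tau> in at_ii_inf.
           dist (r \<tau> a) ((of_nat L + 1) / of_real pi * s a)
           < dist (- r \<tau> a) ((of_nat L + 1) / of_real pi * s a)))"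

end

theory Submission
  imports Defs "HOL-Complex_Analysis.Complex_Analysis"
begin

text \<open>
  Write $\theta(w,\tau) = e^{i\pi\tau/4} f_\tau(w)$. In the series for $f_\tau$ the terms
  $n = 0$ and $n = -1$ do not depend on $\tau$ and add up to $2 \sin(\pi w)$; in every other
  term $n(n+1) \ge 2$, so on a fixed ball all of them together are
  $O(e^{-2\pi \mathrm{Im}\,\tau})$, uniformly in $w$ (\<open>reduced_theta_minus_sin_le\<close>).
  As locally uniform convergence of holomorphic functions passes to derivatives,
  $f_\tau'(0) \to 2\pi$ as well. The factor $e^{i\pi\tau/4}$ cancels in $[z]$, whence
  $[z] \to \frac{L+1}{\pi} \langle z\rangle$ for every $z$ (\<open>tendsto_ell\<close>).

  The square of the elliptic root therefore converges to the square of
  $\frac{L+1}{\pi}$ times the trigonometric root, and the choice of the nearer branch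
  makes the roots themselves converge (\<open>tendsto_compatible_root\<close>).

  Every coefficient of the two elliptic operators is homogeneous of degree $0$ in the
  brackets and the root together, so the constants $\frac{L+1}{\pi}$ cancel in the limit.
  For $T_A$ this already gives the trigonometric operator. For $\check R_A$ the limit is
  the same formula with $\langle\cdot\rangle$ in place of $[\cdot]$, which the addition
  theorem of the sine identifies with
  $\mathrm{id} + \frac{\langle z\rangle}{\langle 1-z\rangle} T_A$ (\<open>R_tri_expand\<close>).
\<close>

section \<open>The theta series without its leading exponential\<close>

text \<open>
  The exponent uses $(n+\frac12)^2 - \frac14 = n(n+1)$, so that the terms $n = 0, -1$
  are free of $\tau$.
\<close>

definition nome_term :: "complex \<Rightarrow> complex \<Rightarrow> int \<Rightarrow> complex" where
  "nome_term \<tau> w n =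
     exp (\<i> * of_real pi * of_int (n * (n + 1)) * \<tau>
          + 2 * of_real pi * \<i> * (of_int n + 1/2) * (w + 1/2))"

definition reduced_theta :: "complex \<Rightarrow> complex \<Rightarrow> complex" where
  "reduced_theta \<tau> w = - (\<Sum>\<^sub>\<infinity>n\<in>UNIV. nome_term \<tau> w n)"

text \<open>
  A majorant, independent of $\tau$, of the $n$-th term for $|w| \le R$ and
  $\mathrm{Im}\,\tau \ge 1$: it is the largest possible modulus at
  $\mathrm{Im}\,\tau = 1$.
\<close>

definition term_bound :: "real \<Rightarrow> int \<Rightarrow> real" where
  "term_bound R n = exp (pi * (\<bar>of_int (2 * n + 1)\<bar> * R - of_int (n * (n + 1))))"

lemma theta_eq_reduced_theta:
  "theta w \<tau> = exp (\<i> * of_real pi * \<tau> / 4) * reduced_theta \<tau> w"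
proof -
  have "exp (\<i> * of_real pi * (of_int n + 1/2)\<^sup>2 * \<tau>
              + 2 * of_real pi * \<i> * (of_int n + 1/2) * (w + 1/2))
        = exp (\<i> * of_real pi * \<tau> / 4) * nome_term \<tau> w n" for n :: int
    unfolding nome_term_def exp_add [symmetric]
    by (rule arg_cong [where f = exp]) (simp add: power2_eq_square field_simps)
  then show ?thesis
    by (simp add: theta_def reduced_theta_def infsum_cmult_right')
qed

text \<open>
  Completing the square turns the Gaussian decay into a geometric bound for $n \ge 0$, and
  the reflection $n \mapsto -1-n$, which preserves both $|2n+1|$ and $n(n+1)$, carries it
  over to $n < 0$.
\<close>

lemma term_bound_summable: "term_bound R summable_on UNIV"
proof -
  have le: "term_bound R (int k) \<le> exp (pi * (R + R\<^sup>2)) * exp (- pi) ^ k" for k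
  proof -
    have "0 \<le> (real k - R)\<^sup>2" by simp
    then have "\<bar>of_int (2 * int k + 1)\<bar> * R - of_int (int k * (int k + 1)) \<le> R + R\<^sup>2 - real k"
      by (simp add: power2_eq_square algebra_simps)
    then have "pi * (\<bar>of_int (2 * int k + 1)\<bar> * R - of_int (int k * (int k + 1)))
               \<le> pi * (R + R\<^sup>2 - real k)"
      by (intro mult_left_mono) auto
    also have "\<dots> = pi * (R + R\<^sup>2) + real k * (- pi)"
      by (simp add: algebra_simps)
    finally show ?thesis
      unfolding term_bound_def exp_of_nat_mult [symmetric] exp_add [symmetric] by simp
  qed
  have "summable (\<lambda>k. exp (pi * (R + R\<^sup>2)) * exp (- pi) ^ k)"
    by (intro summable_mult summable_geometric) simp
  then have "summable (\<lambda>k. term_bound R (int k))"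
    by (rule summable_comparison_test') (use le in \<open>auto simp: term_bound_def\<close>)
  then have nat: "(term_bound R \<circ> int) summable_on UNIV"
    by (subst summable_on_UNIV_nonneg_real_iff) (auto simp: term_bound_def o_def)
  define refl where "refl = (\<lambda>k. - int k - 1)"
  have "term_bound R (refl k) = term_bound R (int k)" for k
    by (simp add: term_bound_def refl_def algebra_simps)
  then have "term_bound R \<circ> refl = term_bound R \<circ> int"
    by auto
  with nat have neg: "(term_bound R \<circ> refl) summable_on UNIV"
    by simp
  have inj: "inj int" "inj refl"
    by (auto simp: inj_on_def refl_def)
  have "term_bound R summable_on (range int \<union> range refl)"
  proof (rule summable_on_Un_disjoint)
    show "range int \<inter> range refl = {}"
      by (auto simp: refl_def)
  qed (use nat neg inj in \<open>simp_all add: summable_on_reindex\<close>)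
  also have "range int \<union> range refl = UNIV"
  proof -
    have "n \<in> range int \<union> range refl" for n
    proof (cases "n \<ge> 0")
      case True
      then have "n = int (nat n)" by simp
      then show ?thesis by blast
    next
      case False
      then have "n = refl (nat (- n - 1))" by (simp add: refl_def)
      then show ?thesis by blast
    qed
    then show ?thesis by blast
  qed
  finally show ?thesis .
qed

text \<open>
  Splitting off the value at $\mathrm{Im}\,\tau = 1$ separates what makes the series
  summable (the majorant) from what makes its tail small (the exponential factor).
\<close>

lemma norm_nome_term_le:
  assumes "norm w \<le> R"
  shows "norm (nome_term \<tau> w n)
         \<le> exp (- (pi * of_int (n * (n + 1)) * (Im \<tau> - 1))) * term_bound R n"
proof -
  have "\<bar>of_int (2 * n + 1) * Im w\<bar> \<le> \<bar>of_int (2 * n + 1)\<bar> * R"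
    unfolding abs_mult using abs_Im_le_cmod [of w] assms by (intro mult_left_mono) auto
  then have "pi * (- (of_int (2 * n + 1) * Im w)) \<le> pi * (\<bar>of_int (2 * n + 1)\<bar> * R)"
    by (intro mult_left_mono) auto
  moreover have "norm (nome_term \<tau> w n)
      = exp (pi * (- (of_int (2 * n + 1) * Im w)) - pi * of_int (n * (n + 1)) * Im \<tau>)"
    unfolding nome_term_def norm_exp_eq_Re
    by (simp add: algebra_simps)
  ultimately show ?thesis
    unfolding term_bound_def exp_add [symmetric] by (simp add: algebra_simps)
qed

lemma norm_nome_term_le_term_bound:
  assumes "norm w \<le> R" "Im \<tau> \<ge> 1"
  shows "norm (nome_term \<tau> w n) \<le> term_bound R n"
proof -
  have "0 \<le> n * (n + 1)"
    by (cases "n \<ge> 0") (auto simp: zero_le_mult_iff)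
  then have "0 \<le> pi * of_int (n * (n + 1)) * (Im \<tau> - 1)"
    using assms by (intro mult_nonneg_nonneg) (simp_all del: of_int_mult)
  then have "exp (- (pi * of_int (n * (n + 1)) * (Im \<tau> - 1))) * term_bound R n \<le> term_bound R n"
    by (intro mult_left_le_one_le) (simp_all add: term_bound_def)
  with norm_nome_term_le [OF assms(1), of \<tau> n] show ?thesis
    by linarith
qed

lemma reduced_theta_holomorphic:
  assumes "Im \<tau> \<ge> 1"
  shows "reduced_theta \<tau> holomorphic_on ball 0 R"
proof -
  have lim: "uniform_limit (cball 0 R) (\<lambda>X w. \<Sum>n\<in>X. nome_term \<tau> w n)
          (\<lambda>w. \<Sum>\<^sub>\<infinity>n\<in>UNIV. nome_term \<tau> w n) (finite_subsets_at_top UNIV)"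
    by (rule Weierstrass_m_test_general [OF _ term_bound_summable [of R]])
       (use norm_nome_term_le_term_bound assms in auto)
  have partial: "\<forall>\<^sub>F X in finite_subsets_at_top UNIV.
                   continuous_on (cball 0 R) (\<lambda>w. \<Sum>n\<in>X. nome_term \<tau> w n) \<and>
                 (\<lambda>w. \<Sum>n\<in>X. nome_term \<tau> w n) holomorphic_on ball 0 R"
    unfolding nome_term_def
    by (intro always_eventually allI conjI continuous_intros holomorphic_intros) auto
  have "(\<lambda>w. \<Sum>\<^sub>\<infinity>n\<in>UNIV. nome_term \<tau> w n) holomorphic_on ball 0 R"
    by (rule holomorphic_uniform_limit [OF partial lim finite_subsets_at_top_neq_bot])
  then show ?thesis
    unfolding reduced_theta_def by (intro holomorphic_intros)
qed

section \<open>Degeneration to the sine\<close>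

text \<open>
  The terms $n = 0, -1$ give $2\sin(\pi w)$, and $n(n+1) \ge 2$ for all the others lets a
  common factor $e^{-2\pi(\mathrm{Im}\,\tau - 1)}$ be taken out of the tail.
\<close>

lemma reduced_theta_minus_sin_le:
  assumes "norm w \<le> R" "Im \<tau> \<ge> 1"
  shows "norm (reduced_theta \<tau> w - 2 * sin (of_real pi * w))
         \<le> exp (- (2 * pi * (Im \<tau> - 1))) * (\<Sum>\<^sub>\<infinity>n\<in>UNIV. term_bound R n)"
proof -
  define D where "D = UNIV - {0, -1 :: int}"
  have UNIV_eq: "UNIV = {0, -1} \<union> D" and disj: "{0, -1} \<inter> D = {}"
    by (auto simp: D_def)
  have "(\<lambda>n. norm (nome_term \<tau> w n)) summable_on UNIV"
    using term_bound_summable [of R] norm_nome_term_le_term_bound [OF assms]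
    by (rule Infinite_Sum.abs_summable_on_comparison_test')
  then have abs_summable: "(\<lambda>n. norm (nome_term \<tau> w n)) summable_on A" for A
    by (rule summable_on_subset_banach) simp
  have "infsum (nome_term \<tau> w) UNIV = infsum (nome_term \<tau> w) {0, -1} + infsum (nome_term \<tau> w) D"
    unfolding UNIV_eq using disj
    by (intro infsum_Un_disjoint abs_summable_summable [OF abs_summable]) auto
  moreover have "infsum (nome_term \<tau> w) {0, -1} = - 2 * sin (of_real pi * w)"
  proof -
    have "nome_term \<tau> w 0 = exp (\<i> * (of_real pi * w)) * exp (\<i> * of_real (pi / 2))"
      unfolding nome_term_def exp_add [symmetric] by (rule arg_cong [where f = exp]) (simp add: algebra_simps)
    moreover have "nome_term \<tau> w (-1) = exp (- (\<i> * (of_real pi * w))) * exp (\<i> * of_real (- (pi / 2)))"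
      unfolding nome_term_def exp_add [symmetric] by (rule arg_cong [where f = exp]) (simp add: algebra_simps)
    moreover have "exp (\<i> * of_real (pi / 2)) = \<i>" "exp (\<i> * of_real (- (pi / 2))) = - \<i>"
      unfolding cis_conv_exp [symmetric] by (simp_all add: complex_eq_iff)
    ultimately have "nome_term \<tau> w 0 + nome_term \<tau> w (-1) =
        \<i> * (exp (\<i> * (of_real pi * w)) - exp (- (\<i> * (of_real pi * w))))"
      by (simp add: algebra_simps)
    also have "\<dots> = - 2 * sin (of_real pi * w)"
      unfolding sin_exp_eq by (simp add: field_simps)
    finally show ?thesis
      by simp
  qed
  ultimately have "reduced_theta \<tau> w - 2 * sin (of_real pi * w) = - infsum (nome_term \<tau> w) D"
    by (simp add: reduced_theta_def)
  also have "norm \<dots> \<le> infsum (\<lambda>n. norm (nome_term \<tau> w n)) D"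
    by (simp add: norm_infsum_bound abs_summable)
  also have "\<dots> \<le> infsum (\<lambda>n. exp (- (2 * pi * (Im \<tau> - 1))) * term_bound R n) D"
  proof (rule infsum_mono)
    fix n assume "n \<in> D"
    then have "n \<ge> 1 \<or> n \<le> -2"
      by (auto simp: D_def)
    then have "2 \<le> n * (n + 1)"
    proof
      assume "n \<ge> 1"
      then show ?thesis using mult_mono [of 1 n 2 "n + 1"] by simp
    next
      assume "n \<le> -2"
      then show ?thesis using mult_mono [of 2 "- n" 1 "- n - 1"] by (simp add: algebra_simps)
    qed
    then have "(2 :: real) \<le> of_int (n * (n + 1))"
      by linarith
    then have "2 * pi * (Im \<tau> - 1) \<le> pi * of_int (n * (n + 1)) * (Im \<tau> - 1)"
      using assms by (intro mult_right_mono) (auto simp del: of_int_mult)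
    then have "exp (- (pi * of_int (n * (n + 1)) * (Im \<tau> - 1))) * term_bound R n
               \<le> exp (- (2 * pi * (Im \<tau> - 1))) * term_bound R n"
      by (intro mult_right_mono) (auto simp: term_bound_def simp del: of_int_mult)
    with norm_nome_term_le [OF assms(1), of \<tau> n]
    show "norm (nome_term \<tau> w n) \<le> exp (- (2 * pi * (Im \<tau> - 1))) * term_bound R n"
      by linarith
  qed (auto intro!: abs_summable summable_on_cmult_right summable_on_subset_banach [OF term_bound_summable])
  also have "\<dots> = exp (- (2 * pi * (Im \<tau> - 1))) * infsum (term_bound R) D"
    by (rule infsum_cmult_right')
  also have "\<dots> \<le> exp (- (2 * pi * (Im \<tau> - 1))) * infsum (term_bound R) UNIV"
    by (intro mult_left_mono infsum_mono2 term_bound_summable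
        summable_on_subset_banach [OF term_bound_summable]) (simp_all add: term_bound_def)
  finally show ?thesis .
qed

lemma filterlim_Im_at_ii_inf: "filterlim Im at_top at_ii_inf"
  unfolding at_ii_inf_def by (rule filterlim_filtercomap)

lemma eventually_Im_ge: "\<forall>\<^sub>F \<tau> in at_ii_inf. Im \<tau> \<ge> t"
  using filterlim_Im_at_ii_inf unfolding filterlim_at_top by blast

lemma at_ii_inf_neq_bot: "at_ii_inf \<noteq> bot"
  unfolding at_ii_inf_def
  by (rule filtercomap_neq_bot_surj)
     (auto simp: surj_def intro: exI [of _ "Complex 0 _"] complex.sel(2) [symmetric])

lemma reduced_theta_uniform_limit:
  "uniform_limit (ball 0 R) reduced_theta (\<lambda>w. 2 * sin (of_real pi * w)) at_ii_inf"
proof (rule uniform_limitI)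
  fix \<epsilon> :: real assume "\<epsilon> > 0"
  have "((\<lambda>t. exp (- (2 * pi * (t - 1))) * infsum (term_bound R) UNIV) \<longlongrightarrow> 0) at_top"
  proof (rule tendsto_mult_left_zero, rule filterlim_compose [OF exp_at_bot])
    have "filterlim (\<lambda>t. 2 * pi * (t - 1)) at_top at_top"
      by (rule filterlim_tendsto_pos_mult_at_top [OF tendsto_const])
         (auto intro: filterlim_tendsto_add_at_top [OF tendsto_const [of "-1"] filterlim_ident, simplified])
    then show "filterlim (\<lambda>t. - (2 * pi * (t - 1))) at_bot at_top"
      by (simp add: filterlim_uminus_at_bot)
  qed
  from filterlim_compose [OF this filterlim_Im_at_ii_inf]
  have "\<forall>\<^sub>F \<tau> in at_ii_inf. exp (- (2 * pi * (Im \<tau> - 1))) * infsum (term_bound R) UNIV < \<epsilon>"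
    using \<open>\<epsilon> > 0\<close> by (rule order_tendstoD)
  with eventually_Im_ge [of 1]
  show "\<forall>\<^sub>F \<tau> in at_ii_inf. \<forall>w\<in>ball 0 R. dist (reduced_theta \<tau> w) (2 * sin (of_real pi * w)) < \<epsilon>"
  proof eventually_elim
    case (elim \<tau>)
    show ?case
    proof
      fix w :: complex assume "w \<in> ball 0 R"
      then have "norm w \<le> R" by simp
      from reduced_theta_minus_sin_le [OF this elim(1)] elim(2)
      show "dist (reduced_theta \<tau> w) (2 * sin (of_real pi * w)) < \<epsilon>"
        by (simp add: dist_norm)
    qed
  qed
qed

lemma tendsto_reduced_theta:
  "((\<lambda>\<tau>. reduced_theta \<tau> w) \<longlongrightarrow> 2 * sin (of_real pi * w)) at_ii_inf"
  by (rule tendsto_uniform_limitI [OF reduced_theta_uniform_limit [of "norm w + 1"]]) simp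

text \<open>
  By Cauchy's integral formula, uniform convergence near $0$ of functions holomorphic there
  controls their derivatives; this is what the uniformity in $w$ of the bound above is for.
\<close>

lemma tendsto_deriv_reduced_theta:
  "((\<lambda>\<tau>. deriv (reduced_theta \<tau>) 0) \<longlongrightarrow> 2 * of_real pi) at_ii_inf"
proof -
  have "((\<lambda>\<tau>. deriv (reduced_theta \<tau>) 0) \<longlongrightarrow> deriv (\<lambda>w. 2 * sin (of_real pi * w)) 0) at_ii_inf"
  proof (rule deriv_complex_uniform_limit [OF reduced_theta_uniform_limit])
    show "\<forall>\<^sub>F \<tau> in at_ii_inf. reduced_theta \<tau> holomorphic_on ball 0 1"
      using eventually_Im_ge [of 1] by eventually_elim (rule reduced_theta_holomorphic)
  qed (use at_ii_inf_neq_bot in auto)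
  also have "deriv (\<lambda>w. 2 * sin (of_real pi * w)) 0 = 2 * (of_real pi :: complex)"
    by (rule DERIV_imp_deriv) (auto intro!: derivative_eq_intros)
  finally show ?thesis .
qed

lemma ell_eq_reduced_theta:
  assumes "Im \<tau> \<ge> 1"
  shows "ell L \<tau> z =
    reduced_theta \<tau> (z / (of_nat L + 1)) / (deriv (reduced_theta \<tau>) 0 / (of_nat L + 1))"
proof -
  have "reduced_theta \<tau> field_differentiable at 0"
    using reduced_theta_holomorphic [OF assms, of 1]
    by (simp add: holomorphic_on_imp_differentiable_at [of _ "ball 0 1"])
  then have "deriv (\<lambda>w. theta w \<tau>) 0 = exp (\<i> * of_real pi * \<tau> / 4) * deriv (reduced_theta \<tau>) 0"
    unfolding theta_eq_reduced_theta by (rule deriv_cmult)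
  then show ?thesis
    by (simp add: ell_def theta_eq_reduced_theta)
qed

lemma tendsto_ell:
  "((\<lambda>\<tau>. ell L \<tau> z) \<longlongrightarrow> (of_nat L + 1) / of_real pi * tri L z) at_ii_inf"
proof -
  have L: "(of_nat L + 1 :: complex) \<noteq> 0"
    by (metis of_nat_Suc of_nat_neq_0 add.commute)
  have "((\<lambda>\<tau>. reduced_theta \<tau> (z / (of_nat L + 1)) / (deriv (reduced_theta \<tau>) 0 / (of_nat L + 1)))
     \<longlongrightarrow> 2 * sin (of_real pi * (z / (of_nat L + 1))) / (2 * of_real pi / (of_nat L + 1))) at_ii_inf"
    using L by (intro tendsto_intros tendsto_reduced_theta tendsto_deriv_reduced_theta) auto
  also have "2 * sin (of_real pi * (z / (of_nat L + 1))) / (2 * of_real pi / (of_nat L + 1))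
             = (of_nat L + 1) / of_real pi * tri L z"
    using L by (simp add: tri_def field_simps)
  finally show ?thesis
    by (rule Lim_transform_eventually)
       (use eventually_Im_ge [of 1] in \<open>eventually_elim, simp add: ell_eq_reduced_theta\<close>)
qed

section \<open>The square roots\<close>

text \<open>
  If $|f - l| < |f + l|$ then $|f - l|^2 \le |f - l|\,|f + l| = |f^2 - l^2|$. This
  gives convergence also at $l = 0$, where the two branches merge.
\<close>

lemma tendsto_of_square_tendsto_of_closer:
  fixes f :: "'a \<Rightarrow> complex"
  assumes sq: "((\<lambda>x. (f x)\<^sup>2) \<longlongrightarrow> l\<^sup>2) F"
    and closer: "\<forall>\<^sub>F x in F. dist (f x) l < dist (- f x) l"
  shows "(f \<longlongrightarrow> l) F"
proof -
  have "((\<lambda>x. sqrt (norm ((f x)\<^sup>2 - l\<^sup>2))) \<longlongrightarrow> sqrt (norm (l\<^sup>2 - l\<^sup>2))) F"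
    by (intro tendsto_intros sq)
  then have "((\<lambda>x. sqrt (norm ((f x)\<^sup>2 - l\<^sup>2))) \<longlongrightarrow> 0) F"
    by simp
  moreover have "\<forall>\<^sub>F x in F. norm (f x - l) \<le> sqrt (norm ((f x)\<^sup>2 - l\<^sup>2))"
    using closer
  proof eventually_elim
    case (elim x)
    have "dist (- f x) l = norm (f x + l)"
      unfolding dist_norm using norm_minus_cancel [of "f x + l"] by simp
    with elim have "norm (f x - l) \<le> norm (f x + l)"
      by (simp add: dist_norm)
    then have "(norm (f x - l))\<^sup>2 \<le> norm (f x - l) * norm (f x + l)"
      unfolding power2_eq_square by (intro mult_left_mono) auto
    also have "\<dots> = norm ((f x)\<^sup>2 - l\<^sup>2)"
      by (simp add: norm_mult [symmetric] power2_eq_square algebra_simps)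
    finally show ?case
      by (rule real_le_rsqrt)
  qed
  ultimately have "((\<lambda>x. f x - l) \<longlongrightarrow> 0) F"
    by (rule Lim_null_comparison [rotated])
  then show ?thesis
    by (simp add: LIM_zero_iff)
qed

text \<open>
  A real number in $\mathbb{Z} + \tau\mathbb{Z}$ is an integer, and $\frac1{L+1}$ lies
  strictly between $0$ and $1$.
\<close>

lemma admissible_of_Im_pos:
  assumes "L \<ge> 1" "Im \<tau> > 0"
  shows "admissible L \<tau>"
proof -
  have False if eq: "1 / (of_nat L + 1) = of_int m + \<tau> * of_int n" for m n :: int
  proof -
    have real: "(1 / (of_nat L + 1) :: complex) = of_real (1 / (real L + 1))"
      by simp
    have "Im \<tau> * of_int n = 0"
      using arg_cong [OF eq, of Im] unfolding real by simp
    with assms have "n = 0" by simp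
    then have "1 / (real L + 1) = of_int m"
      using arg_cong [OF eq, of Re] unfolding real by simp
    moreover have "0 < 1 / (real L + 1)" "1 / (real L + 1) < 1"
      using assms by simp_all
    ultimately have "0 < m" "m < 1" by simp_all
    then show False by simp
  qed
  with assms show ?thesis
    unfolding admissible_def by blast
qed

lemma tendsto_compatible_root:
  assumes "L \<ge> 1" "compatible_roots L b r s" "a - b \<in> \<int>"
  shows "((\<lambda>\<tau>. r \<tau> a) \<longlongrightarrow> (of_nat L + 1) / of_real pi * s a) at_ii_inf"
proof (rule tendsto_of_square_tendsto_of_closer)
  let ?c = "(of_nat L + 1) / of_real pi :: complex"
  have s: "(s a)\<^sup>2 = tri L (a - 1) * tri L (a + 1)"
    and r: "\<And>\<tau>. admissible L \<tau> \<Longrightarrow> (r \<tau> a)\<^sup>2 = ell L \<tau> (a - 1) * ell L \<tau> (a + 1)"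
    using assms unfolding compatible_roots_def by blast+
  have "((\<lambda>\<tau>. ell L \<tau> (a - 1) * ell L \<tau> (a + 1))
          \<longlongrightarrow> (?c * tri L (a - 1)) * (?c * tri L (a + 1))) at_ii_inf"
    by (intro tendsto_mult tendsto_ell)
  also have "(?c * tri L (a - 1)) * (?c * tri L (a + 1)) = (?c * s a)\<^sup>2"
    unfolding power_mult_distrib s by (simp add: power2_eq_square)
  finally have lim: "((\<lambda>\<tau>. ell L \<tau> (a - 1) * ell L \<tau> (a + 1)) \<longlongrightarrow> (?c * s a)\<^sup>2) at_ii_inf" .
  have "\<forall>\<^sub>F \<tau> in at_ii_inf. ell L \<tau> (a - 1) * ell L \<tau> (a + 1) = (r \<tau> a)\<^sup>2"
    using eventually_Im_ge [of 1]
  proof eventually_elim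
    case (elim \<tau>)
    then have "admissible L \<tau>"
      using assms(1) by (intro admissible_of_Im_pos) auto
    then show ?case by (simp only: r)
  qed
  with lim show "((\<lambda>\<tau>. (r \<tau> a)\<^sup>2) \<longlongrightarrow> (?c * s a)\<^sup>2) at_ii_inf"
    by (rule Lim_transform_eventually)
  show "\<forall>\<^sub>F \<tau> in at_ii_inf. dist (r \<tau> a) (?c * s a) < dist (- r \<tau> a) (?c * s a)"
    using assms unfolding compatible_roots_def by blast
qed

section \<open>The operators\<close>

lemma tendsto_op_scale [tendsto_intros]:
  "(f \<longlongrightarrow> c) F \<Longrightarrow> ((\<lambda>x. f x *\<^sub>o A) \<longlongrightarrow> c *\<^sub>o A) F"
  unfolding op_scale_def by (intro tendsto_intros)

text \<open>
  After division by $\langle a\rangle\langle 1-z\rangle$, the left-hand sides are the diagonal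
  entries of $\mathrm{id} + \frac{\langle z\rangle}{\langle 1-z\rangle} T_A$ on
  $e_1 \otimes e_2$ and $e_2 \otimes e_1$, and the right-hand sides those of the trigonometric
  analogue of $\check R_A^{\mathrm{ell}}$. Both identities follow by expanding with the addition
  theorem in $\frac{\pi}{L+1}$ times $1$, $a$ and $z$.
\<close>

lemma tri_addition:
  "tri L (1 - z) * tri L a + tri L z * tri L (a + 1) = tri L (a + z) * tri L 1"
  "tri L (1 - z) * tri L a + tri L z * tri L (a - 1) = tri L (a - z) * tri L 1"
  unfolding tri_def
  by (simp_all add: sin_add sin_diff add_divide_distrib diff_divide_distrib algebra_simps)

lemma mat_1_eq_tensor:
  "mat 1 = (\<Sum>i\<in>UNIV. E i i \<otimes>\<^sub>m E i i) + E 1 1 \<otimes>\<^sub>m E 2 2 + E 2 2 \<otimes>\<^sub>m E 1 1"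
proof -
  have "mat 1 $ (i, j) $ (k, l) =
     ((\<Sum>i\<in>UNIV. E i i \<otimes>\<^sub>m E i i) + E 1 1 \<otimes>\<^sub>m E 2 2 + E 2 2 \<otimes>\<^sub>m E 1 1) $ (i, j) $ (k, l)"
    for i j k l :: 2
    using exhaust_2 [of i] exhaust_2 [of j] exhaust_2 [of k] exhaust_2 [of l]
    by (elim disjE) (simp_all add: sum_2 mat_def tensor_def E_def)
  then show ?thesis
    by (simp add: vec_eq_iff split_paired_all)
qed

text \<open>
  Brings $\check R_A^{\mathrm{tri}}$ into the shape in which $\check R_A^{\mathrm{ell}}$ is
  given, so that the limit can be taken coefficient by coefficient.
\<close>

lemma R_tri_expand:
  assumes "tri L a \<noteq> 0" "tri L (1 - z) \<noteq> 0"
  shows "R_tri L \<rho> z a =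
     (\<Sum>i\<in>UNIV. E i i \<otimes>\<^sub>m E i i)
     + (\<rho> * tri L z / (tri L a * tri L (1 - z)))
         *\<^sub>o (E 2 1 \<otimes>\<^sub>m E 1 2 + E 1 2 \<otimes>\<^sub>m E 2 1)
     + (tri L (a + z) * tri L 1 / (tri L a * tri L (1 - z)))
         *\<^sub>o (E 1 1 \<otimes>\<^sub>m E 2 2)
     + (tri L (a - z) * tri L 1 / (tri L a * tri L (1 - z)))
         *\<^sub>o (E 2 2 \<otimes>\<^sub>m E 1 1)"
  unfolding R_tri_def T_tri_def mat_1_eq_tensor tri_addition [symmetric]
  using assms by (simp add: vec_eq_iff op_scale_def field_simps)

theorem lemma2p31:
  fixes L :: nat and b :: complex
    and r :: "complex \<Rightarrow> complex \<Rightarrow> complex" and s :: "complex \<Rightarrow> complex"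
  assumes "L \<ge> 2"
    and b_generic: "\<And>a. a - b \<in> \<int> \<Longrightarrow> tri L a \<noteq> 0"
    and roots: "compatible_roots L b r s"
  shows "(\<forall>a z. a - b \<in> \<int> \<longrightarrow> tri L (1 - z) \<noteq> 0 \<longrightarrow>
            ((\<lambda>\<tau>. R_ell L \<tau> (r \<tau> a) z a) \<longlongrightarrow> R_tri L (s a) z a) at_ii_inf)
       \<and> (\<forall>a. a - b \<in> \<int> \<longrightarrow>
            ((\<lambda>\<tau>. T_ell L \<tau> (r \<tau> a) a) \<longlongrightarrow> T_tri L (s a) a) at_ii_inf)"
proof (intro conjI allI impI)
  define c :: complex where "c = (of_nat L + 1) / of_real pi"
  have "(of_nat L + 1 :: complex) \<noteq> 0"
    by (metis of_nat_Suc of_nat_neq_0 add.commute)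
  then have c: "c \<noteq> 0"
    by (simp add: c_def)
  have ell: "((\<lambda>\<tau>. ell L \<tau> z) \<longlongrightarrow> c * tri L z) at_ii_inf" for z
    unfolding c_def by (rule tendsto_ell)
  have root: "((\<lambda>\<tau>. r \<tau> a) \<longlongrightarrow> c * s a) at_ii_inf" if "a - b \<in> \<int>" for a
    unfolding c_def using \<open>L \<ge> 2\<close> roots that by (intro tendsto_compatible_root) auto
  fix a assume a: "a - b \<in> \<int>"
  note a0 = b_generic [OF a]
  have cancel: "c * x / (c * y) = x / y" "(c * x) * (c * x') / ((c * y) * (c * y')) = x * x' / (y * y')"
    for x x' y y' using c by simp_all
  have "((\<lambda>\<tau>. T_ell L \<tau> (r \<tau> a) a) \<longlongrightarrow>
     (c * s a / (c * tri L a)) *\<^sub>o (E 2 1 \<otimes>\<^sub>m E 1 2 + E 1 2 \<otimes>\<^sub>m E 2 1)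
     + (c * tri L (a + 1) / (c * tri L a)) *\<^sub>o (E 1 1 \<otimes>\<^sub>m E 2 2)
     + (c * tri L (a - 1) / (c * tri L a)) *\<^sub>o (E 2 2 \<otimes>\<^sub>m E 1 1)) at_ii_inf"
    unfolding T_ell_def using c a0 by (intro tendsto_intros ell root a) auto
  then show "((\<lambda>\<tau>. T_ell L \<tau> (r \<tau> a) a) \<longlongrightarrow> T_tri L (s a) a) at_ii_inf"
    unfolding cancel T_tri_def .
  fix z assume z0: "tri L (1 - z) \<noteq> 0"
  have "((\<lambda>\<tau>. R_ell L \<tau> (r \<tau> a) z a) \<longlongrightarrow>
     (\<Sum>i\<in>UNIV. E i i \<otimes>\<^sub>m E i i)
     + ((c * s a) * (c * tri L z) / ((c * tri L a) * (c * tri L (1 - z))))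
         *\<^sub>o (E 2 1 \<otimes>\<^sub>m E 1 2 + E 1 2 \<otimes>\<^sub>m E 2 1)
     + ((c * tri L (a + z)) * (c * tri L 1) / ((c * tri L a) * (c * tri L (1 - z))))
         *\<^sub>o (E 1 1 \<otimes>\<^sub>m E 2 2)
     + ((c * tri L (a - z)) * (c * tri L 1) / ((c * tri L a) * (c * tri L (1 - z))))
         *\<^sub>o (E 2 2 \<otimes>\<^sub>m E 1 1)) at_ii_inf"
    unfolding R_ell_def using c a0 z0 by (intro tendsto_intros ell root a) auto
  then show "((\<lambda>\<tau>. R_ell L \<tau> (r \<tau> a) z a) \<longlongrightarrow> R_tri L (s a) z a) at_ii_inf"
    unfolding cancel R_tri_expand [OF a0 z0] .
qed

end
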